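(* Let $$\mathbf{A}=\begin{pmatrix}\mathbf{B}^{\forall}&\mathbf{b}^{\exists}\\ \mathbf{C}^{\forall}&\mathbf{c}^{\forall}\end{pmatrix}\in\mathbb{IR}^{n\times n}$$ be a quantified square interval matrix, where $\mathbf{B}^{\forall}\in\mathbb{IR}^{k\times(n-1)}$, $\mathbf{C}^{\forall}\in\mathbb{IR}^{(n-k)\times(n-1)}$ and $\mathbf{c}^{\forall}\in\mathbb{IR}^{n-k}$ are universally quantified, and the column vector $\mathbf{b}^{\exists}\in\mathbb{IR}^{k}$ is existentially quantified, with $b^{\exists}_\Delta>0$ (every entry of $\mathbf{b}^{\exists}$ has positive radius); the lower block $(\mathbf{C}^{\forall}\;\mathbf{c}^{\forall})$ may be empty. Then $\mathbf{A}$ is AE regular if and only if the interval matrices $((\mathbf{B}^{\forall})^T\;(\mathbf{C}^{\forall})^T)$ and $(\mathbf{C}^{\forall}\;\mathbf{c}^{\forall})$ both have strongly full row rank.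
   Context: An interval matrix is a set $\mathbf{A}=\{A\in\mathbb{R}^{m\times n} : \underline{A}\le A\le\overline{A}\}$, where $\underline{A}\le\overline{A}$ are given real matrices and inequalities are entrywise; $\mathbb{IR}^{m\times n}$ is the set of all $m\times n$ interval matrices, and interval vectors are a special case. The radius matrix of $\mathbf{A}$ is $A_\Delta=\frac12(\overline{A}-\underline{A})$. A quantified interval matrix has each interval entry associated with either the universal or the existential quantifier. It is AE regular if for every choice of values of the universally quantified entries from their intervals there is a choice of values of the existentially quantified entries from their intervals such that the resulting real matrix is nonsingular. An interval matrix $\mathbf{M}$ has strongly full row rank if every real matrix $M\in\mathbf{M}$ has full row rank (linearly independent rows); an empty matrix with no rows has full row rank. *)

theory Defs
  imports "Jordan_Normal_Form.VS_Connect" "HOL-Library.Interval"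
begin

text \<open>
  An interval matrix is represented by the matrix of its interval entries; \<open>real interval\<close> is
  the type of pairs of endpoints \<open>l \<le> u\<close>, so \<open>map_mat lower A \<le> map_mat upper A\<close> holds by
  construction. An interval column vector is an interval matrix with one column.
\<close>

definition mats_of :: "real interval mat \<Rightarrow> real mat set" where
  "mats_of A = {M. map_mat lower A \<le> M \<and> M \<le> map_mat upper A}"

definition radius :: "real interval mat \<Rightarrow> real mat" where
  "radius A = (1 / 2) \<cdot>\<^sub>m (map_mat upper A - map_mat lower A)"

datatype quantifier = Universal | Existential

type_synonym quantified_imat = "(quantifier \<times> real interval) mat"

definition all_universal :: "real interval mat \<Rightarrow> quantified_imat" where
  "all_universal A = map_mat (Pair Universal) A"

definition all_existential :: "real interval mat \<Rightarrow> quantified_imat" where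
  "all_existential A = map_mat (Pair Existential) A"

definition positions :: "quantifier \<Rightarrow> quantified_imat \<Rightarrow> (nat \<times> nat) set" where
  "positions q Q = {(i, j). i < dim_row Q \<and> j < dim_col Q \<and> fst (Q $$ (i, j)) = q}"

text \<open>
  A function in \<open>choices q Q\<close> selects a value for each entry of \<open>Q\<close> quantified by \<open>q\<close>; its
  values at all other positions are unconstrained, and \<open>realization\<close> does not use them.
\<close>

definition choices :: "quantifier \<Rightarrow> quantified_imat \<Rightarrow> (nat \<times> nat \<Rightarrow> real) set" where
  "choices q Q = {f. \<forall>p \<in> positions q Q. f p \<in> set_of (snd (Q $$ p))}"

definition realization ::
  "quantified_imat \<Rightarrow> (nat \<times> nat \<Rightarrow> real) \<Rightarrow> (nat \<times> nat \<Rightarrow> real) \<Rightarrow> real mat" where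
  "realization Q u e = mat (dim_row Q) (dim_col Q)
     (\<lambda>p. case fst (Q $$ p) of Universal \<Rightarrow> u p | Existential \<Rightarrow> e p)"

definition AE_regular :: "quantified_imat \<Rightarrow> bool" where
  "AE_regular Q \<longleftrightarrow>
     (\<forall>u \<in> choices Universal Q. \<exists>e \<in> choices Existential Q. invertible_mat (realization Q u e))"

text \<open>
  Linear independence of the family of rows: \<open>lin_dep\<close> is a property of sets, so
  repeated rows have to be excluded separately.
\<close>

definition full_row_rank :: "real mat \<Rightarrow> bool" where
  "full_row_rank M \<longleftrightarrow> distinct (rows M) \<and>
     \<not> LinearCombinations.module.lin_dep class_ring (module_vec TYPE(real) (dim_col M)) (set (rows M))"

definition strongly_full_row_rank :: "real interval mat \<Rightarrow> bool" where
  "strongly_full_row_rank A \<longleftrightarrow> (\<forall>M \<in> mats_of A. full_row_rank M)"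

text \<open>The block matrix \<open>(A B)\<close>; the column counterpart of \<^const>\<open>append_rows\<close>.\<close>

definition append_cols :: "'a :: zero mat \<Rightarrow> 'a mat \<Rightarrow> 'a mat" where
  "append_cols A B = four_block_mat A B (0\<^sub>m 0 (dim_col A)) (0\<^sub>m 0 (dim_col B))"

end

theory Submission
  imports Defs "Jordan_Normal_Form.DL_Rank"
begin

text \<open>
  Fix real matrices \<open>B\<close>, \<open>C\<close>, \<open>c\<close> in their intervals. A nonzero left null vector \<open>v = (v\<^sub>1, v\<^sub>2)\<close>
  of the tall matrix \<open>(B; C)\<close> maps the completed square matrix to
  \<open>(0, \<dots>, 0, b\<^sup>T v\<^sub>1 + c\<^sup>T v\<^sub>2)\<close>, so, if \<open>(B; C)\<close> has full column rank, the matrix is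
  nonsingular as soon as this last entry is nonzero. Moving one entry of \<open>b\<close> inside its
  nondegenerate interval achieves this if \<open>v\<^sub>1 \<noteq> 0\<close>; and if \<open>v\<^sub>1 = 0\<close>, then the entry is
  \<open>c\<^sup>T v\<^sub>2\<close>, which is nonzero when \<open>(C c)\<close> has full row rank.
\<close>

section \<open>Full row rank as a trivial left kernel\<close>

text \<open>A repeated row is itself a dependency, with kernel vector
  \<open>unit_vec m i - unit_vec m j\<close>; once the rows are distinct, a dependency of the set of
  rows is the same thing as a nonzero vector in the kernel of the transpose. So both clauses of the
  definition merge into one kernel condition.\<close>

lemma full_row_rank_iff:
  assumes "M \<in> carrier_mat m n"
  shows "full_row_rank M \<longleftrightarrow>
    (\<forall>v \<in> carrier_vec m. transpose_mat M *\<^sub>v v = 0\<^sub>v n \<longrightarrow> v = 0\<^sub>v m)"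
proof -
  interpret vec_space "TYPE(real)" n .
  have T: "transpose_mat M \<in> carrier_mat n m" using assms by simp
  have rank: "full_row_rank M \<longleftrightarrow>
      distinct (cols (transpose_mat M)) \<and> lin_indpt (set (cols (transpose_mat M)))"
    using assms unfolding full_row_rank_def by simp
  have "distinct (cols (transpose_mat M))"
    if inj: "\<forall>v \<in> carrier_vec m. transpose_mat M *\<^sub>v v = 0\<^sub>v n \<longrightarrow> v = 0\<^sub>v m"
  proof (rule ccontr)
    assume "\<not> distinct (cols (transpose_mat M))"
    then obtain i j where ij: "i < m" "j < m" "i \<noteq> j"
        and eq: "cols (transpose_mat M) ! i = cols (transpose_mat M) ! j"
      using T by (auto simp: distinct_conv_nth)
    have "transpose_mat M *\<^sub>v (unit_vec m i - unit_vec m j)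
        = transpose_mat M *\<^sub>v unit_vec m i - transpose_mat M *\<^sub>v unit_vec m j"
      by (rule mult_minus_distrib_mat_vec[OF T]) auto
    also have "\<dots> = 0\<^sub>v n"
    proof -
      have "transpose_mat M *\<^sub>v unit_vec m r = cols (transpose_mat M) ! r" if "r < m" for r
        using that T by (intro eq_vecI) auto
      then show ?thesis using eq ij T by simp
    qed
    finally have "unit_vec m i - unit_vec m j = (0\<^sub>v m :: real vec)"
      using inj by simp
    then have "(unit_vec m i - unit_vec m j) $ i = (0\<^sub>v m :: real vec) $ i" by simp
    then show False using ij by simp
  qed
  moreover have "lin_dep (set (cols (transpose_mat M))) \<longleftrightarrow>
      (\<exists>v \<in> carrier_vec m. transpose_mat M *\<^sub>v v = 0\<^sub>v n \<and> v \<noteq> 0\<^sub>v m)"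
    if "distinct (cols (transpose_mat M))"
  proof
    assume "lin_dep (set (cols (transpose_mat M)))"
    from lin_depE[OF T this that]
    show "\<exists>v \<in> carrier_vec m. transpose_mat M *\<^sub>v v = 0\<^sub>v n \<and> v \<noteq> 0\<^sub>v m" by blast
  next
    assume "\<exists>v \<in> carrier_vec m. transpose_mat M *\<^sub>v v = 0\<^sub>v n \<and> v \<noteq> 0\<^sub>v m"
    then obtain v where "v \<in> carrier_vec m" "v \<noteq> 0\<^sub>v m" "transpose_mat M *\<^sub>v v = 0\<^sub>v n" by blast
    then show "lin_dep (set (cols (transpose_mat M)))" using that by (rule lin_depI[OF T])
  qed
  ultimately show ?thesis unfolding rank by blast
qed

text \<open>Transposition turns \<open>(X Y)\<close> into a stack of two matrices, and the kernel of
  a stack is the intersection of the kernels.\<close>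

lemma full_row_rank_append_cols_iff:
  assumes X: "X \<in> carrier_mat m n1" and Y: "Y \<in> carrier_mat m n2"
  shows "full_row_rank (append_cols X Y) \<longleftrightarrow>
    (\<forall>v \<in> carrier_vec m. transpose_mat X *\<^sub>v v = 0\<^sub>v n1 \<and> transpose_mat Y *\<^sub>v v = 0\<^sub>v n2
       \<longrightarrow> v = 0\<^sub>v m)"
proof -
  have carrier: "append_cols X Y \<in> carrier_mat m (n1 + n2)"
    using assms unfolding append_cols_def by auto
  \<comment> \<open>The lower blocks of \<open>append_cols\<close> have no rows, so their transposes
    are the blocks without columns that occur in \<open>append_rows\<close>.\<close>
  have T: "transpose_mat (append_cols X Y) = transpose_mat X @\<^sub>r transpose_mat Y"
    unfolding append_cols_def append_rows_def
    using assms by (subst transpose_four_block_mat[of _ m n1 _ n2 _ 0]) auto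
  have zero: "0\<^sub>v (n1 + n2) = 0\<^sub>v n1 @\<^sub>v (0\<^sub>v n2 :: real vec)" by auto
  have "transpose_mat (append_cols X Y) *\<^sub>v v = 0\<^sub>v (n1 + n2) \<longleftrightarrow>
      transpose_mat X *\<^sub>v v = 0\<^sub>v n1 \<and> transpose_mat Y *\<^sub>v v = 0\<^sub>v n2"
    if "v \<in> carrier_vec m" for v
    unfolding T zero
    by (subst mat_mult_append[of _ n1 m _ n2]; (subst append_vec_eq[of _ n1])?)
      (use assms that in auto)
  then show ?thesis unfolding full_row_rank_iff[OF carrier] by blast
qed

section \<open>Nonsingularity through determinants and kernels\<close>

lemma invertible_mat_iff_det:
  fixes A :: "'a :: field mat"
  assumes A: "A \<in> carrier_mat n n"
  shows "invertible_mat A \<longleftrightarrow> det A \<noteq> 0"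
proof
  assume "invertible_mat A"
  then obtain B where AB: "A * B = 1\<^sub>m n" and BA: "B * A = 1\<^sub>m (dim_row B)"
    using A unfolding invertible_mat_def inverts_mat_def by auto
  \<comment> \<open>The definition of invertibility does not prescribe the size of the inverse;
    comparing column counts in the two products forces it to be square.\<close>
  have "dim_col (A * B) = n" "dim_col (B * A) = dim_row B" using AB BA by simp_all
  then have "B \<in> carrier_mat n n" using A by auto
  then have "det A * det B = 1" using det_mult[OF A] AB by (metis det_one)
  then show "det A \<noteq> 0" by auto
next
  assume "det A \<noteq> 0"
  \<comment> \<open>Here \<open>()\<close> closes the extensible record \<open>ring_mat\<close>; a
    unit of this ring is a matrix with a two-sided inverse of the same size.\<close>
  from det_non_zero_imp_unit[OF A this, of "()"]
  obtain B where "B \<in> carrier_mat n n" "A * B = 1\<^sub>m n" "B * A = 1\<^sub>m n"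
    unfolding Units_def ring_mat_def by auto
  then show "invertible_mat A"
    using A unfolding invertible_mat_def inverts_mat_def by auto
qed

lemma invertible_mat_iff_kernel:
  fixes A :: "'a :: field mat"
  assumes A: "A \<in> carrier_mat n n"
  shows "invertible_mat A \<longleftrightarrow> (\<forall>v \<in> carrier_vec n. A *\<^sub>v v = 0\<^sub>v n \<longrightarrow> v = 0\<^sub>v n)"
proof -
  have "invertible_mat A \<longleftrightarrow> \<not> (\<exists>v. v \<in> carrier_vec n \<and> v \<noteq> 0\<^sub>v n \<and> A *\<^sub>v v = 0\<^sub>v n)"
    using invertible_mat_iff_det[OF A] det_0_iff_vec_prod_zero_field[OF A] by (rule trans[OF _ arg_cong])
  then show ?thesis by blast
qed

text \<open>The determinant is invariant under transposition. This makes nonsingularity usable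
  against left null vectors too.\<close>

lemma invertible_mat_transpose:
  fixes A :: "'a :: field mat"
  assumes A: "A \<in> carrier_mat n n" and inv: "invertible_mat A"
  shows "invertible_mat (transpose_mat A)"
proof -
  have "det (transpose_mat A) \<noteq> 0"
    using inv unfolding invertible_mat_iff_det[OF A] det_transpose[OF A] .
  then show ?thesis using invertible_mat_iff_det[of "transpose_mat A" n] A by simp
qed

section \<open>Members of interval matrices and of their blocks\<close>

text \<open>The order on matrices includes equality of dimensions, so membership fixes the size;
  beyond that, the entries vary independently.\<close>

lemma mats_of_iff:
  assumes "A \<in> carrier_mat m n"
  shows "M \<in> mats_of A \<longleftrightarrow>
    M \<in> carrier_mat m n \<and> (\<forall>i<m. \<forall>j<n. M $$ (i, j) \<in> set_of (A $$ (i, j)))"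
proof -
  have dim: "dim_row A = m" "dim_col A = n" using assms by auto
  have "M \<in> mats_of A \<longleftrightarrow> M \<in> carrier_mat m n \<and>
      (\<forall>i<m. \<forall>j<n. lower (A $$ (i, j)) \<le> M $$ (i, j) \<and> M $$ (i, j) \<le> upper (A $$ (i, j)))"
    unfolding mats_of_def less_eq_mat_def mem_Collect_eq index_map_mat carrier_mat_def dim
    using dim by (metis index_map_mat(1))
  then show ?thesis by (simp add: set_of_eq)
qed

lemma mats_of_carrier:
  "A \<in> carrier_mat m n \<Longrightarrow> M \<in> mats_of A \<Longrightarrow> M \<in> carrier_mat m n"
  by (simp add: mats_of_iff)

text \<open>Witnesses that an interval matrix is nonempty, since the interval type guarantees
  ordered endpoints.\<close>

lemma lower_in_mats_of: "map_mat lower A \<in> mats_of A"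
  by (auto simp: mats_of_def less_eq_mat_def)

lemma mats_of_transpose: "mats_of (transpose_mat A) = transpose_mat ` mats_of A"
proof -
  \<comment> \<open>One inclusion, stated for every \<open>A\<close>, is enough: transposition is an
    involution, so the instance at the transpose of \<open>A\<close> gives the other.\<close>
  have "transpose_mat M \<in> mats_of (transpose_mat A)" if "M \<in> mats_of A"
    for M and A :: "real interval mat"
    using that by (auto simp: mats_of_iff[OF carrier_matI[OF refl refl]])
  then show ?thesis by (metis transpose_transpose image_eqI image_subsetI subsetI subset_antisym)
qed

lemma mats_of_append_cols:
  assumes A: "A \<in> carrier_mat m n1" and B: "B \<in> carrier_mat m n2"
  shows "mats_of (append_cols A B) = {append_cols X Y | X Y. X \<in> mats_of A \<and> Y \<in> mats_of B}"
    (is "_ = ?R")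
proof -
  have AB: "append_cols A B \<in> carrier_mat m (n1 + n2)"
    using assms unfolding append_cols_def by auto
  have "M \<in> ?R" if M: "M \<in> mats_of (append_cols A B)" for M
  proof -
    define X where "X = mat m n1 (\<lambda>(i, j). M $$ (i, j))"
    define Y where "Y = mat m n2 (\<lambda>(i, j). M $$ (i, j + n1))"
    have Mc: "M \<in> carrier_mat m (n1 + n2)"
      and Me: "\<And>i j. i < m \<Longrightarrow> j < n1 + n2 \<Longrightarrow> M $$ (i, j) \<in> set_of (append_cols A B $$ (i, j))"
      using M mats_of_iff[OF AB] by auto
    have "X \<in> mats_of A"
    proof -
      have "M $$ (i, j) \<in> set_of (A $$ (i, j))" if "i < m" "j < n1" for i j
        using Me[of i j] that A B by (simp add: append_cols_def)
      then show ?thesis unfolding mats_of_iff[OF A] X_def by auto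
    qed
    moreover have "Y \<in> mats_of B"
    proof -
      have "M $$ (i, j + n1) \<in> set_of (B $$ (i, j))" if "i < m" "j < n2" for i j
        using Me[of i "j + n1"] that A B by (simp add: append_cols_def)
      then show ?thesis unfolding mats_of_iff[OF B] Y_def by auto
    qed
    moreover have "M = append_cols X Y"
      using Mc by (intro eq_matI) (auto simp: append_cols_def X_def Y_def)
    ultimately show ?thesis by blast
  qed
  moreover have "append_cols X Y \<in> mats_of (append_cols A B)"
    if "X \<in> mats_of A" "Y \<in> mats_of B" for X Y
    using that unfolding mats_of_iff[OF A] mats_of_iff[OF B] mats_of_iff[OF AB]
    using A B by (auto simp: append_cols_def)
  ultimately show ?thesis by blast
qed

lemma strongly_full_row_rank_append_cols:
  assumes "A \<in> carrier_mat m n1" and "B \<in> carrier_mat m n2"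
  shows "strongly_full_row_rank (append_cols A B) \<longleftrightarrow>
    (\<forall>X \<in> mats_of A. \<forall>Y \<in> mats_of B. full_row_rank (append_cols X Y))"
  unfolding strongly_full_row_rank_def mats_of_append_cols[OF assms] by blast

section \<open>Null vectors of a bordered real matrix\<close>

lemma mult_mat_zero_vec:
  fixes A :: "'a :: semiring_0 mat"
  shows "A \<in> carrier_mat m n \<Longrightarrow> A *\<^sub>v 0\<^sub>v n = 0\<^sub>v m"
  by (intro eq_vecI) auto

context
  fixes k l m :: nat and B b C c :: "real mat"
  assumes B: "B \<in> carrier_mat k m" and b: "b \<in> carrier_mat k 1"
    and C: "C \<in> carrier_mat l m" and c: "c \<in> carrier_mat l 1"
    and square: "k + l = m + 1"
begin

private lemma block_carrier: "four_block_mat B b C c \<in> carrier_mat (m + 1) (m + 1)"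
  using four_block_carrier_mat[OF B c, of b C] square by simp

text \<open>A common null vector of \<open>B\<close> and \<open>C\<close>, extended by a final 0, is
  a null vector of the block matrix, and a left null vector of \<open>(C c)\<close>, preceded by
  \<open>k\<close> zeros, is a left null vector of it. Neither depends on \<open>b\<close>, because
  the zeros meet exactly that block.\<close>

lemma invertible_four_block_full_row_rank:
  assumes inv: "invertible_mat (four_block_mat B b C c)"
  shows "full_row_rank (append_cols (transpose_mat B) (transpose_mat C))"
    and "full_row_rank (append_cols C c)"
proof -
  let ?M = "four_block_mat B b C c"
  have "x = 0\<^sub>v m" if x: "x \<in> carrier_vec m" "B *\<^sub>v x = 0\<^sub>v k" "C *\<^sub>v x = 0\<^sub>v l" for x
  proof -
    have "?M *\<^sub>v (x @\<^sub>v 0\<^sub>v 1) = (B *\<^sub>v x + b *\<^sub>v 0\<^sub>v 1) @\<^sub>v (C *\<^sub>v x + c *\<^sub>v 0\<^sub>v 1)"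
      by (rule four_block_mat_mult_vec[OF B b C c x(1)]) simp
    also have "\<dots> = 0\<^sub>v (m + 1)"
      using x mult_mat_zero_vec[OF b] mult_mat_zero_vec[OF c] square by auto
    finally have "x @\<^sub>v 0\<^sub>v 1 = 0\<^sub>v (m + 1)"
      using inv invertible_mat_iff_kernel[OF block_carrier] x(1)
      by (metis append_carrier_vec zero_carrier_vec)
    also have "\<dots> = 0\<^sub>v m @\<^sub>v 0\<^sub>v 1" by auto
    finally show ?thesis using append_vec_eq[OF x(1), of "0\<^sub>v m"] by simp
  qed
  then show "full_row_rank (append_cols (transpose_mat B) (transpose_mat C))"
    using B C by (subst full_row_rank_append_cols_iff[of _ m k _ l]) auto
  have "w = 0\<^sub>v l"
    if w: "w \<in> carrier_vec l" "transpose_mat C *\<^sub>v w = 0\<^sub>v m" "transpose_mat c *\<^sub>v w = 0\<^sub>v 1" for w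
  proof -
    have "transpose_mat ?M *\<^sub>v (0\<^sub>v k @\<^sub>v w)
        = (transpose_mat B *\<^sub>v 0\<^sub>v k + transpose_mat C *\<^sub>v w)
          @\<^sub>v (transpose_mat b *\<^sub>v 0\<^sub>v k + transpose_mat c *\<^sub>v w)"
      unfolding transpose_four_block_mat[OF B b C c]
      by (rule four_block_mat_mult_vec[of _ m k _ l _ 1]) (use B b C c w in auto)
    also have "\<dots> = 0\<^sub>v (m + 1)"
      using w mult_mat_zero_vec[of "transpose_mat B" m k] mult_mat_zero_vec[of "transpose_mat b" 1 k]
        B b by auto
    finally have "0\<^sub>v k @\<^sub>v w = 0\<^sub>v (m + 1)"
      using invertible_mat_transpose[OF block_carrier inv] block_carrier
        invertible_mat_iff_kernel[of "transpose_mat ?M" "m + 1"] w(1) square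
      by (metis append_carrier_vec transpose_carrier_mat zero_carrier_vec)
    also have "\<dots> = 0\<^sub>v k @\<^sub>v 0\<^sub>v l" using square by auto
    finally show ?thesis using append_vec_eq[of "0\<^sub>v k" k "0\<^sub>v k" w "0\<^sub>v l"] by simp
  qed
  then show "full_row_rank (append_cols C c)"
    using full_row_rank_append_cols_iff[OF C c] by blast
qed

text \<open>Let \<open>x = (x1, x2)\<close> be a null vector of the block matrix. Pairing the zero
  product with \<open>(v1, v2)\<close> and moving the matrix to the other side leaves only the last
  coordinate, \<open>?t $ 0 * x2 $ 0 = 0\<close>, so \<open>x2\<close> vanishes. Then
  \<open>B\<close> and \<open>C\<close> both annihilate \<open>x1\<close>, and \<open>rank\<close>
  gives \<open>x1 = 0\<close>.\<close>

lemma invertible_four_blockI: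
  assumes rank: "full_row_rank (append_cols (transpose_mat B) (transpose_mat C))"
    and v: "v1 \<in> carrier_vec k" "v2 \<in> carrier_vec l"
    and null: "transpose_mat B *\<^sub>v v1 + transpose_mat C *\<^sub>v v2 = 0\<^sub>v m"
    and ne: "(transpose_mat b *\<^sub>v v1 + transpose_mat c *\<^sub>v v2) $ 0 \<noteq> 0"
  shows "invertible_mat (four_block_mat B b C c)"
proof -
  let ?M = "four_block_mat B b C c"
  let ?t = "transpose_mat b *\<^sub>v v1 + transpose_mat c *\<^sub>v v2"
  have "x = 0\<^sub>v (m + 1)" if x: "x \<in> carrier_vec (m + 1)" and Mx: "?M *\<^sub>v x = 0\<^sub>v (m + 1)" for x
  proof -
    define x1 where "x1 = vec_first x m"
    define x2 where "x2 = vec_last x 1"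
    have x12: "x1 \<in> carrier_vec m" "x2 \<in> carrier_vec 1" "x = x1 @\<^sub>v x2"
      unfolding x1_def x2_def using x by auto
    have vM: "transpose_mat ?M *\<^sub>v (v1 @\<^sub>v v2) = 0\<^sub>v m @\<^sub>v ?t"
      unfolding transpose_four_block_mat[OF B b C c]
      by (subst four_block_mat_mult_vec[of _ m k _ l _ 1]) (use B b C c v null in auto)
    have "(transpose_mat ?M *\<^sub>v (v1 @\<^sub>v v2)) \<bullet> x = (v1 @\<^sub>v v2) \<bullet> (?M *\<^sub>v x)"
      by (rule transpose_vec_mult_scalar[OF block_carrier x])
        (use v square in \<open>metis append_carrier_vec\<close>)
    also have "\<dots> = 0"
      unfolding Mx using v square by (metis append_carrier_vec scalar_prod_right_zero)
    finally have "(0\<^sub>v m @\<^sub>v ?t) \<bullet> (x1 @\<^sub>v x2) = 0"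
      unfolding vM x12(3) .
    moreover have "(0\<^sub>v m @\<^sub>v ?t) \<bullet> (x1 @\<^sub>v x2) = 0\<^sub>v m \<bullet> x1 + ?t \<bullet> x2"
      by (rule scalar_prod_append[of _ m _ 1]) (use b c v x12 in auto)
    ultimately have "?t \<bullet> x2 = 0"
      using x12(1) by simp
    moreover have "?t \<bullet> x2 = ?t $ 0 * x2 $ 0"
      using x12(2) by (simp add: scalar_prod_def)
    ultimately have "?t $ 0 * x2 $ 0 = 0" by simp
    then have x2: "x2 = 0\<^sub>v 1"
      using ne x12(2) by (intro eq_vecI) auto
    have "(B *\<^sub>v x1 + b *\<^sub>v x2) @\<^sub>v (C *\<^sub>v x1 + c *\<^sub>v x2) = 0\<^sub>v (m + 1)"
      using Mx four_block_mat_mult_vec[OF B b C c x12(1,2)] x12(3) by simp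
    also have "\<dots> = 0\<^sub>v k @\<^sub>v 0\<^sub>v l" unfolding square[symmetric] by auto
    finally have split: "(B *\<^sub>v x1 + b *\<^sub>v x2) @\<^sub>v (C *\<^sub>v x1 + c *\<^sub>v x2) = 0\<^sub>v k @\<^sub>v 0\<^sub>v l" .
    have "B *\<^sub>v x1 + b *\<^sub>v x2 \<in> carrier_vec k" using B b x12(1,2) by auto
    from split[unfolded append_vec_eq[OF this zero_carrier_vec]]
    have "B *\<^sub>v x1 + b *\<^sub>v x2 = 0\<^sub>v k" "C *\<^sub>v x1 + c *\<^sub>v x2 = 0\<^sub>v l" by simp_all
    then have "B *\<^sub>v x1 = 0\<^sub>v k" "C *\<^sub>v x1 = 0\<^sub>v l"
      unfolding x2 using mult_mat_zero_vec[OF b] mult_mat_zero_vec[OF c] B C x12 by auto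
    then have "x1 = 0\<^sub>v m"
      using rank B C x12(1) by (subst (asm) full_row_rank_append_cols_iff[of _ m k _ l]) auto
    then show ?thesis unfolding x12(3) x2 by auto
  qed
  then show ?thesis using invertible_mat_iff_kernel[OF block_carrier] by blast
qed

end

text \<open>The tall matrix has one row more than columns. Padded with a zero column it becomes
  square and singular, hence so does its transpose, whose kernel supplies the vector.\<close>

lemma ex_left_null_vector:
  fixes B C :: "'a :: field mat"
  assumes B: "B \<in> carrier_mat k m" and C: "C \<in> carrier_mat l m" and square: "k + l = m + 1"
  obtains v1 v2 where "v1 \<in> carrier_vec k" "v2 \<in> carrier_vec l"
    "v1 \<noteq> 0\<^sub>v k \<or> v2 \<noteq> 0\<^sub>v l" "transpose_mat B *\<^sub>v v1 + transpose_mat C *\<^sub>v v2 = 0\<^sub>v m"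
proof -
  let ?M = "four_block_mat B (0\<^sub>m k 1) C (0\<^sub>m l 1)"
  have M: "?M \<in> carrier_mat (m + 1) (m + 1)"
    using four_block_carrier_mat[OF B, of "0\<^sub>m l 1" l 1] square by simp
  \<comment> \<open>The last unit vector selects the zero column, which shows that \<open>?M\<close>
    is singular.\<close>
  have "?M *\<^sub>v (0\<^sub>v m @\<^sub>v unit_vec 1 0)
      = (B *\<^sub>v 0\<^sub>v m + 0\<^sub>m k 1 *\<^sub>v unit_vec 1 0) @\<^sub>v (C *\<^sub>v 0\<^sub>v m + 0\<^sub>m l 1 *\<^sub>v unit_vec 1 0)"
    by (rule four_block_mat_mult_vec[OF B _ C]) auto
  also have "\<dots> = 0\<^sub>v (m + 1)"
    using mult_mat_zero_vec[OF B] mult_mat_zero_vec[OF C] square[symmetric] by auto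
  finally have "?M *\<^sub>v (0\<^sub>v m @\<^sub>v unit_vec 1 0) = 0\<^sub>v (m + 1)" .
  moreover have "0\<^sub>v m @\<^sub>v unit_vec 1 0 \<noteq> (0\<^sub>v (m + 1) :: 'a vec)"
  proof
    assume "0\<^sub>v m @\<^sub>v unit_vec 1 0 = (0\<^sub>v (m + 1) :: 'a vec)"
    then have "(0\<^sub>v m @\<^sub>v unit_vec 1 0) $ m = (0\<^sub>v (m + 1) :: 'a vec) $ m" by simp
    then show False by simp
  qed
  ultimately have "det ?M = 0"
    unfolding det_0_iff_vec_prod_zero_field[OF M] by (metis append_carrier_vec unit_vec_carrier zero_carrier_vec)
  then have "det (transpose_mat ?M) = 0" using det_transpose[OF M] by simp
  then obtain v where v: "v \<in> carrier_vec (k + l)" "v \<noteq> 0\<^sub>v (k + l)"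
      and null: "transpose_mat ?M *\<^sub>v v = 0\<^sub>v (m + 1)"
    using det_0_iff_vec_prod_zero_field[of "transpose_mat ?M" "m + 1"] M square by auto
  define v1 where "v1 = vec_first v k"
  define v2 where "v2 = vec_last v l"
  have v12: "v1 \<in> carrier_vec k" "v2 \<in> carrier_vec l" "v = v1 @\<^sub>v v2"
    unfolding v1_def v2_def using v by auto
  have "transpose_mat ?M *\<^sub>v v =
      (transpose_mat B *\<^sub>v v1 + transpose_mat C *\<^sub>v v2)
      @\<^sub>v (transpose_mat (0\<^sub>m k 1) *\<^sub>v v1 + transpose_mat (0\<^sub>m l 1) *\<^sub>v v2)"
    unfolding v12(3)
    by (subst transpose_four_block_mat[OF B _ C])
      (auto intro!: four_block_mat_mult_vec[of _ m k _ l _ 1] simp: B C v12)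
  also have "transpose_mat ?M *\<^sub>v v = 0\<^sub>v m @\<^sub>v 0\<^sub>v 1" unfolding null by auto
  finally have "transpose_mat B *\<^sub>v v1 + transpose_mat C *\<^sub>v v2 = 0\<^sub>v m"
    using append_vec_eq[of "0\<^sub>v m" m "transpose_mat B *\<^sub>v v1 + transpose_mat C *\<^sub>v v2"] B C v12(1,2) by auto
  moreover have "v1 \<noteq> 0\<^sub>v k \<or> v2 \<noteq> 0\<^sub>v l" using v v12 by auto
  ultimately show thesis using that v12 by blast
qed

section \<open>Choosing the existential column for fixed remaining blocks\<close>

text \<open>Necessity holds for every completion. For sufficiency, a left null vector of the tall
  matrix is fixed first, since it does not involve \<open>b'\<close>; it remains to choose
  \<open>b'\<close> so that the pairing of this vector with the last column is nonzero.\<close>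

lemma ex_invertible_completion_iff:
  assumes B: "B \<in> carrier_mat k m" and b: "b \<in> carrier_mat k 1"
    and C: "C \<in> carrier_mat l m" and c: "c \<in> carrier_mat l 1"
    and square: "k + l = m + 1"
    and radius: "\<forall>i<k. radius b $$ (i, 0) > 0"
  shows "(\<exists>b' \<in> mats_of b. invertible_mat (four_block_mat B b' C c)) \<longleftrightarrow>
    full_row_rank (append_cols (transpose_mat B) (transpose_mat C)) \<and>
    full_row_rank (append_cols C c)"
proof
  assume "\<exists>b' \<in> mats_of b. invertible_mat (four_block_mat B b' C c)"
  then obtain b' where b': "b' \<in> mats_of b" "invertible_mat (four_block_mat B b' C c)"
    by blast
  then show "full_row_rank (append_cols (transpose_mat B) (transpose_mat C)) \<and>
      full_row_rank (append_cols C c)"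
    using invertible_four_block_full_row_rank[OF B mats_of_carrier[OF b] C c square] by blast
next
  assume rank: "full_row_rank (append_cols (transpose_mat B) (transpose_mat C)) \<and>
    full_row_rank (append_cols C c)"
  obtain v1 v2 where v: "v1 \<in> carrier_vec k" "v2 \<in> carrier_vec l"
    and ne: "v1 \<noteq> 0\<^sub>v k \<or> v2 \<noteq> 0\<^sub>v l"
    and null: "transpose_mat B *\<^sub>v v1 + transpose_mat C *\<^sub>v v2 = 0\<^sub>v m"
    using ex_left_null_vector[OF B C square] .
  \<comment> \<open>The pairing \<open>t\<close> is affine in \<open>b'\<close>, with linear
    coefficients \<open>v1\<close>.\<close>
  define t where "t b' = (transpose_mat b' *\<^sub>v v1 + transpose_mat c *\<^sub>v v2) $ 0" for b'
  let ?bl = "map_mat lower b"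
  have t: "t b' = (\<Sum>i<k. b' $$ (i, 0) * v1 $ i) + (transpose_mat c *\<^sub>v v2) $ 0"
    if "b' \<in> carrier_mat k 1" for b'
    using that v c by (simp add: t_def scalar_prod_def atLeast0LessThan)
  have "\<exists>b' \<in> mats_of b. t b' \<noteq> 0"
  proof (cases "v1 = 0\<^sub>v k")
    case True
    \<comment> \<open>With \<open>v1 = 0\<close>, \<open>t\<close> is constant in \<open>b'\<close>;
      were it zero, the nonzero \<open>v2\<close> would contradict the rank of
      \<open>(C c)\<close>.\<close>
    have "transpose_mat C *\<^sub>v v2 = 0\<^sub>v m"
      using null B C v unfolding True by (simp add: mult_mat_zero_vec[of _ m k])
    then have "transpose_mat c *\<^sub>v v2 \<noteq> 0\<^sub>v 1"
      using rank full_row_rank_append_cols_iff[OF C c] v(2) ne True by blast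
    then have "(transpose_mat c *\<^sub>v v2) $ 0 \<noteq> 0"
      using c by (auto simp: vec_eq_iff)
    then have "t ?bl \<noteq> 0" using t[of ?bl] b True by simp
    then show ?thesis using lower_in_mats_of by blast
  next
    case False
    then obtain i where i: "i < k" "v1 $ i \<noteq> 0" using v(1) by (auto simp: vec_eq_iff)
    \<comment> \<open>\<open>bu\<close> differs from \<open>?bl\<close> only in row
      \<open>i\<close>, where \<open>v1\<close> is nonzero. So the values of \<open>t\<close> differ
      by the width of that interval, twice its positive radius, times \<open>v1 $ i\<close>, and
      cannot both vanish.\<close>
    define bu where "bu = mat k 1 (\<lambda>(j, _). if j = i then upper (b $$ (j, 0)) else lower (b $$ (j, 0)))"
    have bu: "bu \<in> mats_of b"
      unfolding mats_of_iff[OF b] bu_def by (auto simp: set_of_eq)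
    have "t bu - t ?bl = (\<Sum>j<k. (bu $$ (j, 0) - ?bl $$ (j, 0)) * v1 $ j)"
      using t[of bu] t[of ?bl] b mats_of_carrier[OF b bu]
      by (simp add: sum_subtractf left_diff_distrib)
    also have "\<dots> = (\<Sum>j<k. if j = i then (upper (b $$ (i, 0)) - lower (b $$ (i, 0))) * v1 $ i else 0)"
      using b by (intro sum.cong) (auto simp: bu_def)
    also have "\<dots> = (upper (b $$ (i, 0)) - lower (b $$ (i, 0))) * v1 $ i"
      using i by simp
    also have "\<dots> \<noteq> 0"
      using radius[rule_format, OF i(1)] i b by (simp add: radius_def)
    finally have "t bu \<noteq> 0 \<or> t ?bl \<noteq> 0" by auto
    then show ?thesis using bu lower_in_mats_of by blast
  qed
  then show "\<exists>b' \<in> mats_of b. invertible_mat (four_block_mat B b' C c)"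
    using invertible_four_blockI[OF B mats_of_carrier[OF b] C c square] rank v null
    unfolding t_def by blast
qed

section \<open>From choice functions on positions to choices of blocks\<close>

text \<open>A choice function is constrained only at positions carrying its own quantifier, and
  these positions are unions of whole blocks. Cutting it into blocks therefore translates
  quantification over choices into quantification over real matrices.\<close>

lemma AE_regular_four_block_iff:
  assumes B: "B \<in> carrier_mat k m" and b: "b \<in> carrier_mat k 1"
    and C: "C \<in> carrier_mat l m" and c: "c \<in> carrier_mat l 1"
  shows "AE_regular (four_block_mat (all_universal B) (all_existential b)
                                    (all_universal C) (all_universal c)) \<longleftrightarrow>
    (\<forall>B' \<in> mats_of B. \<forall>C' \<in> mats_of C. \<forall>c' \<in> mats_of c.
       \<exists>b' \<in> mats_of b. invertible_mat (four_block_mat B' b' C' c'))"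
proof -
  define Q where "Q = four_block_mat (all_universal B) (all_existential b)
                                     (all_universal C) (all_universal c)"
  \<comment> \<open>Choice functions are indexed by positions in the whole matrix, so lower blocks
    are read with row offset \<open>k\<close> and right blocks with column offset
    \<open>m\<close>.\<close>
  define blockB where "blockB u = mat k m (\<lambda>(i, j). u (i, j))" for u :: "nat \<times> nat \<Rightarrow> real"
  define blockb where "blockb u = mat k 1 (\<lambda>(i, j). u (i, j + m))" for u :: "nat \<times> nat \<Rightarrow> real"
  define blockC where "blockC u = mat l m (\<lambda>(i, j). u (i + k, j))" for u :: "nat \<times> nat \<Rightarrow> real"
  define blockc where "blockc u = mat l 1 (\<lambda>(i, j). u (i + k, j + m))" for u :: "nat \<times> nat \<Rightarrow> real"
  note block_defs = blockB_def blockb_def blockC_def blockc_def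
  note all_defs = all_universal_def all_existential_def
  have dim: "dim_row Q = k + l" "dim_col Q = m + 1"
    using B c by (simp_all add: Q_def all_defs)
  have Q: "Q $$ (i, j) =
      (if i < k then if j < m then (Universal, B $$ (i, j)) else (Existential, b $$ (i, j - m))
       else if j < m then (Universal, C $$ (i - k, j)) else (Universal, c $$ (i - k, j - m)))"
    if "i < k + l" "j < m + 1" for i j
    using that B b C c by (auto simp: Q_def all_defs)
  have realization: "realization Q u e =
      four_block_mat (blockB u) (blockb e) (blockC u) (blockc u)" for u e
    by (rule eq_matI) (auto simp: realization_def dim Q block_defs less_Suc_eq)
  have choices: "u \<in> choices q Q \<longleftrightarrow>
      (\<forall>i<k + l. \<forall>j<m + 1. fst (Q $$ (i, j)) = q \<longrightarrow> u (i, j) \<in> set_of (snd (Q $$ (i, j))))" for u q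
    unfolding choices_def positions_def dim by auto
  have universal: "u \<in> choices Universal Q \<longleftrightarrow>
      blockB u \<in> mats_of B \<and> blockC u \<in> mats_of C \<and> blockc u \<in> mats_of c" (is "_ \<longleftrightarrow> ?blocks") for u
  proof
    assume "u \<in> choices Universal Q"
    then have u: "u (i, j) \<in> set_of (snd (Q $$ (i, j)))"
      if "i < k + l" "j < m + 1" "fst (Q $$ (i, j)) = Universal" for i j
      using that unfolding choices by blast
    have "u (i, j) \<in> set_of (B $$ (i, j))" if "i < k" "j < m" for i j
      using u[of i j] that by (simp add: Q)
    moreover have "u (i + k, j) \<in> set_of (C $$ (i, j))" if "i < l" "j < m" for i j
      using u[of "i + k" j] that by (simp add: Q)
    moreover have "u (i + k, j + m) \<in> set_of (c $$ (i, j))" if "i < l" "j < 1" for i j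
      using u[of "i + k" "j + m"] that by (simp add: Q)
    ultimately show ?blocks
      unfolding mats_of_iff[OF B] mats_of_iff[OF C] mats_of_iff[OF c] block_defs by auto
  next
    assume ?blocks
    then have uB: "\<forall>i<k. \<forall>j<m. u (i, j) \<in> set_of (B $$ (i, j))"
      and uC: "\<forall>i<l. \<forall>j<m. u (i + k, j) \<in> set_of (C $$ (i, j))"
      and uc: "\<forall>i<l. u (i + k, m) \<in> set_of (c $$ (i, 0))"
      unfolding mats_of_iff[OF B] mats_of_iff[OF C] mats_of_iff[OF c] block_defs by auto
    show "u \<in> choices Universal Q"
      unfolding choices
    proof (intro allI impI)
      fix i j
      assume ij: "i < k + l" "j < m + 1" and fst: "fst (Q $$ (i, j)) = Universal"
      show "u (i, j) \<in> set_of (snd (Q $$ (i, j)))"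
      proof (cases "i < k")
        case True
        then have "j < m" using fst by (simp add: Q[OF ij] split: if_splits)
        then show ?thesis using uB True by (simp add: Q[OF ij])
      next
        case False
        \<comment> \<open>The equation \<open>i - k + k = i\<close> undoes the truncated
          subtraction, which is exact because \<open>i\<close> is not below
          \<open>k\<close>.\<close>
        then have "i - k < l" "i - k + k = i" using ij(1) by simp_all
        moreover have "j = m" if "\<not> j < m" using that ij(2) by simp
        ultimately show ?thesis
          using uC[rule_format, of "i - k" j] uc[rule_format, of "i - k"] False
          by (auto simp: Q[OF ij])
      qed
    qed
  qed
  have existential: "e \<in> choices Existential Q \<longleftrightarrow> blockb e \<in> mats_of b" for e
  proof
    assume "e \<in> choices Existential Q"
    then have e: "e (i, j) \<in> set_of (snd (Q $$ (i, j)))"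
      if "i < k + l" "j < m + 1" "fst (Q $$ (i, j)) = Existential" for i j
      using that unfolding choices by blast
    have "e (i, j + m) \<in> set_of (b $$ (i, j))" if "i < k" "j < 1" for i j
      using e[of i "j + m"] that by (simp add: Q)
    then show "blockb e \<in> mats_of b"
      unfolding mats_of_iff[OF b] block_defs by auto
  next
    assume "blockb e \<in> mats_of b"
    then have eb: "\<forall>i<k. e (i, m) \<in> set_of (b $$ (i, 0))"
      unfolding mats_of_iff[OF b] block_defs by auto
    show "e \<in> choices Existential Q"
      unfolding choices
    proof (intro allI impI)
      fix i j
      assume ij: "i < k + l" "j < m + 1" and fst: "fst (Q $$ (i, j)) = Existential"
      then have "i < k" "j = m" by (auto simp: Q[OF ij] split: if_splits)
      then show "e (i, j) \<in> set_of (snd (Q $$ (i, j)))" using eb by (simp add: Q)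
    qed
  qed
  \<comment> \<open>Any three real blocks come from one function: read it off their assembly, with
    zeros as filler at the existential positions.\<close>
  have universal_surj: "\<exists>u. blockB u = B' \<and> blockC u = C' \<and> blockc u = c'"
    if "B' \<in> carrier_mat k m" "C' \<in> carrier_mat l m" "c' \<in> carrier_mat l 1" for B' C' c'
    by (rule exI[of _ "\<lambda>p. four_block_mat B' (0\<^sub>m k 1) C' c' $$ p"])
      (use that in \<open>auto simp: block_defs intro!: eq_matI\<close>)
  \<comment> \<open>Column \<open>m\<close> of the whole matrix is column 0 of \<open>b'\<close>;
    the values elsewhere are arbitrary.\<close>
  have existential_surj: "\<exists>e. blockb e = b'" if "b' \<in> carrier_mat k 1" for b'
    by (rule exI[of _ "\<lambda>(i, j). b' $$ (i, j - m)"])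
      (use that in \<open>auto simp: block_defs intro!: eq_matI\<close>)
  have completion: "(\<exists>e \<in> choices Existential Q. invertible_mat (realization Q u e)) \<longleftrightarrow>
      (\<exists>b' \<in> mats_of b. invertible_mat (four_block_mat (blockB u) b' (blockC u) (blockc u)))" for u
    unfolding realization Bex_def existential using existential_surj mats_of_carrier[OF b] by metis
  show ?thesis
    unfolding AE_regular_def Q_def[symmetric] completion Ball_def universal
    using universal_surj mats_of_carrier[OF B] mats_of_carrier[OF C] mats_of_carrier[OF c] by metis
qed

section \<open>Combining the pointwise criterion with the universal quantifiers\<close>

theorem theorem10:
  fixes n k :: nat
    and B b C c :: "real interval mat"
  assumes "1 \<le> n" and "k \<le> n"
    and "B \<in> carrier_mat k (n - 1)" and "b \<in> carrier_mat k 1"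
    and "C \<in> carrier_mat (n - k) (n - 1)" and "c \<in> carrier_mat (n - k) 1"
    and "\<forall>i < k. radius b $$ (i, 0) > 0"
  shows "AE_regular (four_block_mat (all_universal B) (all_existential b)
                                    (all_universal C) (all_universal c)) \<longleftrightarrow>
    strongly_full_row_rank (append_cols (transpose_mat B) (transpose_mat C)) \<and>
    strongly_full_row_rank (append_cols C c)"
proof -
  note carriers = assms(3-6)
  \<comment> \<open>The bounds \<open>1 \<le> n\<close> and \<open>k \<le> n\<close> make both
    truncated subtractions exact.\<close>
  have square: "k + (n - k) = n - 1 + 1" using assms(1,2) by simp
  have "AE_regular (four_block_mat (all_universal B) (all_existential b)
                                    (all_universal C) (all_universal c)) \<longleftrightarrow>
    (\<forall>B' \<in> mats_of B. \<forall>C' \<in> mats_of C. \<forall>c' \<in> mats_of c.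
       full_row_rank (append_cols (transpose_mat B') (transpose_mat C')) \<and>
       full_row_rank (append_cols C' c'))"
    unfolding AE_regular_four_block_iff[OF carriers]
    using ex_invertible_completion_iff[OF mats_of_carrier[OF carriers(1)] carriers(2)
        mats_of_carrier[OF carriers(3)] mats_of_carrier[OF carriers(4)] square assms(7)]
    by simp
  \<comment> \<open>The first rank condition does not mention \<open>c'\<close> and the second does
    not mention \<open>B'\<close>. As the interval matrices \<open>c\<close> and \<open>B\<close>
    are nonempty, the universal quantifier splits over the conjunction and these vacuous quantifiers
    drop out.\<close>
  also have "\<dots> \<longleftrightarrow>
    (\<forall>B' \<in> mats_of B. \<forall>C' \<in> mats_of C.
       full_row_rank (append_cols (transpose_mat B') (transpose_mat C'))) \<and>
    (\<forall>C' \<in> mats_of C. \<forall>c' \<in> mats_of c. full_row_rank (append_cols C' c'))"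
    using lower_in_mats_of[of B] lower_in_mats_of[of c] by blast
  also have "\<dots> \<longleftrightarrow>
    strongly_full_row_rank (append_cols (transpose_mat B) (transpose_mat C)) \<and>
    strongly_full_row_rank (append_cols C c)"
    using strongly_full_row_rank_append_cols[OF carriers(3,4)]
      strongly_full_row_rank_append_cols[of "transpose_mat B" "n - 1" k "transpose_mat C" "n - k"]
      carriers
    by (simp add: mats_of_transpose)
  finally show ?thesis .
qed

end
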